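(* There is an absolute constant $C$ such that for every $n$ the following holds. Let $\omega$ be the highest scoring entry to the Busy Beaver contest among all entries of length at most $n$. Then the Kolmogorov complexity of $\omega$ is at least $n-C$. In particular, the length of $\omega$ is at least $n-C$, and $\omega$ is $C$-incompressible.
   Context: Fix a programming language. Busy Beaver contest: a valid entry is a program (algorithm) that halts and outputs a natural number; its score is its output. The Kolmogorov complexity of a finite string $\omega$ is the length of the shortest program that outputs $\omega$. A string is $C$-incompressible if its length is at most $C$ plus its Kolmogorov complexity. *)

theory Defs
  imports Main "HOL-Library.Nat_Bijection" "HOL-Library.Countable"
begin

text \<open>
  Partial recursive functions, with \<open>eval r xs y\<close> meaning that \<open>r\<close> halts on the arguments
  \<open>xs\<close> with value \<open>y\<close>. In \<open>PrimRec f g\<close> the recursion variable is the first argument, and \<open>g\<close>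
  receives the recursion variable, the previous value and the parameters, in this order.
\<close>

datatype recf =
    Zero
  | Succ
  | Proj nat
  | Comp recf "recf list"
  | PrimRec recf recf
  | Mu recf

inductive eval :: "recf \<Rightarrow> nat list \<Rightarrow> nat \<Rightarrow> bool" where
  Zero: "eval Zero xs 0"
| Succ: "eval Succ [x] (Suc x)"
| Proj: "i < length xs \<Longrightarrow> eval (Proj i) xs (xs ! i)"
| Comp: "list_all2 (\<lambda>g y. eval g xs y) gs ys \<Longrightarrow> eval f ys z \<Longrightarrow> eval (Comp f gs) xs z"
| PrimRec_0: "eval f xs y \<Longrightarrow> eval (PrimRec f g) (0 # xs) y"
| PrimRec_Suc: "eval (PrimRec f g) (k # xs) y \<Longrightarrow> eval g (k # y # xs) z
    \<Longrightarrow> eval (PrimRec f g) (Suc k # xs) z"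
| Mu: "eval f (k # xs) 0 \<Longrightarrow> (\<forall>j<k. \<exists>y. eval f (j # xs) (Suc y)) \<Longrightarrow> eval (Mu f) xs k"

text \<open>
  Computability of a partial function between types whose elements are coded by natural numbers.
\<close>

definition partial_computable :: "('b \<Rightarrow> nat) \<Rightarrow> ('c \<Rightarrow> nat) \<Rightarrow> ('b \<Rightarrow> 'c option) \<Rightarrow> bool" where
  "partial_computable cb cc f \<longleftrightarrow>
     (\<exists>r. \<forall>x m. eval r [cb x] m \<longleftrightarrow> (\<exists>y. f x = Some y \<and> m = cc y))"

text \<open>
  Only the letters are numbered by the unspecified injection \<open>to_nat\<close>; as the alphabet is finite,
  computability with respect to the resulting coding of strings does not depend on that choice.
\<close>

definition str_code :: "'a::finite list \<Rightarrow> nat" where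
  "str_code w = list_encode (map to_nat w)"

text \<open>
  A programming language over a finite alphabet: \<open>run p\<close> is the output of the program \<open>p\<close>,
  or \<open>None\<close> if \<open>p\<close> does not halt (or is not a well-formed program). The language is effective,
  and it is universal in the sense used to define Kolmogorov complexity: each computable way of
  describing strings is matched, up to an additive constant in the length of the description.

  Outputs are strings, so the language comes with an effective numeral system: \<open>val y\<close> is the
  number denoted by the string \<open>y\<close>, if any. Several numerals may denote the same number
  (leading zeros, say); \<open>repr\<close> chooses one of them.
\<close>

locale programming_language =
  fixes run :: "'a::finite list \<Rightarrow> 'a list option"
    and val :: "'a list \<Rightarrow> nat option"
    and repr :: "nat \<Rightarrow> 'a list"
  assumes run_computable: "partial_computable str_code str_code run"
    and universal: "\<And>f :: 'a list \<Rightarrow> 'a list option. partial_computable str_code str_code f \<Longrightarrow>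
      \<exists>c. \<forall>x y. f x = Some y \<longrightarrow> (\<exists>p. run p = Some y \<and> length p \<le> length x + c)"
    and val_computable: "partial_computable str_code id val"
    and repr_computable: "partial_computable id str_code (\<lambda>k. Some (repr k))"
    and val_repr: "\<And>k. val (repr k) = Some k"

definition valid_entry :: "('a list \<Rightarrow> 'a list option) \<Rightarrow> ('a list \<Rightarrow> nat option) \<Rightarrow> 'a list \<Rightarrow> bool" where
  "valid_entry run val p \<longleftrightarrow> (\<exists>y k. run p = Some y \<and> val y = Some k)"

definition score :: "('a list \<Rightarrow> 'a list option) \<Rightarrow> ('a list \<Rightarrow> nat option) \<Rightarrow> 'a list \<Rightarrow> nat" where
  "score run val p = the (val (the (run p)))"

definition kolmogorov :: "('a list \<Rightarrow> 'a list option) \<Rightarrow> 'a list \<Rightarrow> nat" where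
  "kolmogorov run w = (LEAST l. \<exists>p. run p = Some w \<and> length p = l)"

definition incompressible :: "('a list \<Rightarrow> 'a list option) \<Rightarrow> nat \<Rightarrow> 'a list \<Rightarrow> bool" where
  "incompressible run C w \<longleftrightarrow> length w \<le> C + kolmogorov run w"

end

theory Submission
  imports Defs
begin

text \<open>
  From any program for \<open>\<omega>\<close> one can compute the score of \<open>\<omega>\<close> and output that score plus one. By
  universality this is done by an entry at most a constant longer than the program for \<open>\<omega>\<close>. It
  beats \<open>\<omega>\<close>, so it is longer than \<open>n\<close>.
\<close>

inductive_cases eval_ProjE: "eval (Proj i) xs y"
inductive_cases eval_SuccE: "eval Succ xs y"
inductive_cases eval_CompE: "eval (Comp f gs) xs z"

lemma eval_Comp_single: "eval (Comp f [g]) xs z \<longleftrightarrow> (\<exists>y. eval g xs y \<and> eval f [y] z)"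
  by (auto elim!: eval_CompE intro!: eval.Comp simp: list_all2_Cons1)

lemma partial_computable_Some: "partial_computable c c Some"
proof -
  have "eval (Proj 0) [c x] m \<longleftrightarrow> m = c x" for x m
    using eval.Proj[of 0 "[c x]"] by (auto elim: eval_ProjE)
  then show ?thesis
    unfolding partial_computable_def by (intro exI[of _ "Proj 0"]) simp
qed

lemma partial_computable_Suc: "partial_computable id id (\<lambda>k. Some (Suc k))"
proof -
  have "eval Succ [k] m \<longleftrightarrow> m = Suc k" for k m
    by (auto elim: eval_SuccE intro: eval.Succ)
  then show ?thesis
    unfolding partial_computable_def by (intro exI[of _ Succ]) simp
qed

text \<open>\<open>Comp\<close> halts only if its inner function halts, which matches the strictness
  of \<open>Option.bind\<close>. The middle coding \<open>cc\<close> must be the same on both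
  sides.\<close>

lemma partial_computable_bind:
  assumes "partial_computable cb cc f" and "partial_computable cc cd g"
  shows "partial_computable cb cd (\<lambda>x. Option.bind (f x) g)"
proof -
  obtain r where r: "\<And>x m. eval r [cb x] m \<longleftrightarrow> (\<exists>y. f x = Some y \<and> m = cc y)"
    using assms(1) unfolding partial_computable_def by auto
  obtain s where s: "\<And>y m. eval s [cc y] m \<longleftrightarrow> (\<exists>z. g y = Some z \<and> m = cd z)"
    using assms(2) unfolding partial_computable_def by auto
  have "eval (Comp s [r]) [cb x] m \<longleftrightarrow> (\<exists>z. Option.bind (f x) g = Some z \<and> m = cd z)" for x m
    by (cases "f x") (auto simp: eval_Comp_single r s)
  then show ?thesis
    unfolding partial_computable_def by blast
qed

lemma kolmogorov_le: "run p = Some w \<Longrightarrow> kolmogorov run w \<le> length p"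
  unfolding kolmogorov_def by (rule Least_le) auto

text \<open>The assumption ensures that \<open>LEAST\<close> ranges over a nonempty set of lengths,
  so that the minimum is realized by an actual program.\<close>

lemma kolmogorov_attained:
  assumes "run p = Some w"
  obtains q where "run q = Some w" and "length q = kolmogorov run w"
proof -
  have "\<exists>q. run q = Some w \<and> length q = kolmogorov run w"
    unfolding kolmogorov_def by (rule LeastI_ex) (use assms in auto)
  then show ?thesis
    using that by blast
qed

context programming_language
begin

text \<open>Under the identity as description method, every string describes itself; universality
  turns this into programs.\<close>

lemma short_program_for_string:
  obtains c where "\<And>w. \<exists>p. run p = Some w \<and> length p \<le> length w + c"
  using universal[OF partial_computable_Some] by auto

lemma short_program_beating_output:
  obtains c where "\<And>p w y k. \<lbrakk>run p = Some w; run w = Some y; val y = Some k\<rbrakk> \<Longrightarrow>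
    \<exists>q. run q = Some (repr (Suc k)) \<and> length q \<le> length p + c"
proof -
  \<comment> \<open>The first \<open>run\<close> recovers the entry from its description
    \<open>p\<close>, the second executes that entry. The other stages decode the output, add one
    and write the result as a numeral.\<close>
  define beat where "beat p =
    Option.bind (Option.bind (Option.bind (Option.bind (run p) run) val) (\<lambda>k. Some (Suc k)))
      (\<lambda>k. Some (repr k))" for p
  have "partial_computable str_code str_code beat"
    unfolding beat_def
    by (intro partial_computable_bind[OF _ repr_computable]
        partial_computable_bind[OF _ partial_computable_Suc]
        partial_computable_bind[OF _ val_computable]
        partial_computable_bind[OF run_computable run_computable])
  from universal[OF this] obtain c
    where c: "\<And>x y. beat x = Some y \<Longrightarrow> \<exists>p. run p = Some y \<and> length p \<le> length x + c"
    by blast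
  show ?thesis
    by (rule that[of c], rule c) (simp add: beat_def)
qed

end

theorem theoremE1:
  fixes run :: "'a::finite list \<Rightarrow> 'a list option"
    and val :: "'a list \<Rightarrow> nat option"
    and repr :: "nat \<Rightarrow> 'a list"
  assumes "programming_language run val repr"
  shows "\<exists>C::nat. \<forall>n::nat. \<forall>\<omega>.
    is_arg_max (score run val) (\<lambda>p. valid_entry run val p \<and> length p \<le> n) \<omega> \<longrightarrow>
      int (kolmogorov run \<omega>) \<ge> int n - int C \<and>
      int (length \<omega>) \<ge> int n - int C \<and>
      incompressible run C \<omega>"
proof -
  interpret programming_language run val repr by fact
  obtain a where a: "\<And>w. \<exists>p. run p = Some w \<and> length p \<le> length w + a"
    by (rule short_program_for_string) blast
  obtain b where b: "\<And>p w y k. \<lbrakk>run p = Some w; run w = Some y; val y = Some k\<rbrakk> \<Longrightarrow>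
      \<exists>q. run q = Some (repr (Suc k)) \<and> length q \<le> length p + b"
    by (rule short_program_beating_output) blast
  \<comment> \<open>Both \<open>a\<close> and \<open>b\<close> come from universality alone, so they
    depend neither on \<open>n\<close> nor on \<omega>. The complexity bound costs \<open>b\<close>;
    passing from complexity to length costs another \<open>a\<close>.\<close>
  show ?thesis
  proof (intro exI[of _ "a + b"] allI impI)
    fix n \<omega>
    assume max: "is_arg_max (score run val) (\<lambda>p. valid_entry run val p \<and> length p \<le> n) \<omega>"
    then obtain y k where y: "run \<omega> = Some y" and k: "val y = Some k" and len: "length \<omega> \<le> n"
      unfolding is_arg_max_def valid_entry_def by blast
    \<comment> \<open>This program serves twice: it shows that some program outputs \<omega>, so
      that a shortest one exists, and it bounds the complexity by the length.\<close>
    obtain p0 where p0: "run p0 = Some \<omega>" "length p0 \<le> length \<omega> + a"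
      using a by blast
    obtain p where p: "run p = Some \<omega>" "length p = kolmogorov run \<omega>"
      using p0(1) by (rule kolmogorov_attained)
    obtain q where q: "run q = Some (repr (Suc k))" "length q \<le> length p + b"
      using b[OF p(1) y k] by blast
    have "valid_entry run val q" "score run val \<omega> < score run val q"
      using q(1) y k by (auto simp: valid_entry_def score_def val_repr)
    \<comment> \<open>The score of \<open>q\<close> is \<open>Suc k\<close> against \<open>k\<close>
      for \<omega>, so \<open>q\<close> cannot be among the entries of length at most
      \<open>n\<close>.\<close>
    then have "n < length q"
      using max unfolding is_arg_max_def by (meson not_less)
    then have "n < kolmogorov run \<omega> + b"
      using q(2) p(2) by simp
    moreover have "kolmogorov run \<omega> \<le> length \<omega> + a"
      using kolmogorov_le[of run, OF p0(1)] p0(2) by simp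
    \<comment> \<open>Incompressibility follows from \<open>length \<omega> \<le> n\<close> and
      \<open>n < kolmogorov run \<omega> + b\<close>.\<close>
    ultimately show "int (kolmogorov run \<omega>) \<ge> int n - int (a + b) \<and>
        int (length \<omega>) \<ge> int n - int (a + b) \<and> incompressible run (a + b) \<omega>"
      using len by (auto simp: incompressible_def)
  qed
qed

end
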